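(* Let $S_1=\{(a,b)\in\mathbb R^2 : 1\le a,\ 1\le a^3b+a^6-a\le 2\}$, $S_2=\{(a,b)\in\mathbb R^2 : 1\le a,\ 1\le a^3b-a^6-a\le 2\}$ and $S=S_1\cup S_2$. Then $\mathcal B_0(S)=\mathbb R$ (only constant polynomials are bounded on $S$), but $\mathcal B_1(S)$ is an infinite-dimensional real vector space.
   Context: For $S\subseteq\mathbb R^2$ and $d\in\mathbb N=\{0,1,2,\dots\}$, $\mathcal B_d(S)=\{p\in\mathbb R[x_1,x_2] : \text{there is } q\in\mathbb R[x_1,x_2] \text{ with total degree } \deg(q)\le 2d \text{ and } p^2\le q \text{ on } S\}$; this is a real vector space. *)

theory Defs
  imports Complex_Main "HOL-Computational_Algebra.Polynomial"
begin

text \<open>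
  The ring R[x1, x2] is represented as R[x1][x2], i.e. by the type \<open>real poly poly\<close>: the inner
  variable is x1 and the outer one is x2, so the coefficient of x1^i x2^j in \<open>p\<close> is
  \<open>coeff (coeff p j) i\<close>.
\<close>

type_synonym bipoly = "real poly poly"

definition bipoly_eval :: "bipoly \<Rightarrow> real \<times> real \<Rightarrow> real" where
  "bipoly_eval p s = poly (poly p [:snd s:]) (fst s)"

definition bipoly_const :: "real \<Rightarrow> bipoly" where
  "bipoly_const c = [:[:c:]:]"

definition bipoly_support :: "bipoly \<Rightarrow> (nat \<times> nat) set" where
  "bipoly_support p = {(i, j). coeff (coeff p j) i \<noteq> 0}"

lemma finite_bipoly_support: "finite (bipoly_support p)"
proof (rule finite_subset)
  show "bipoly_support p \<subseteq> (\<Union>j\<in>{..degree p}. {..degree (coeff p j)} \<times> {j})"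
  proof clarify
    fix i j assume "(i, j) \<in> bipoly_support p"
    then have nz: "coeff (coeff p j) i \<noteq> 0"
      by (simp add: bipoly_support_def)
    then have "coeff p j \<noteq> 0" by auto
    then have "j \<le> degree p" by (rule le_degree)
    moreover have "i \<le> degree (coeff p j)"
      using nz by (rule le_degree)
    ultimately show "(i, j) \<in> (\<Union>j\<in>{..degree p}. {..degree (coeff p j)} \<times> {j})" by auto
  qed
qed simp

text \<open>The zero polynomial gets total degree 0, as for \<^const>\<open>degree\<close>.\<close>

definition total_degree :: "bipoly \<Rightarrow> nat" where
  "total_degree p = Max (insert 0 ((\<lambda>(i, j). i + j) ` bipoly_support p))"

interpretation bipoly: vector_space "\<lambda>c p. bipoly_const c * p"
proof
  have add: "bipoly_const (a + b) = bipoly_const a + bipoly_const b" for a b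
    by (simp add: bipoly_const_def)
  have mult: "bipoly_const (a * b) = bipoly_const a * bipoly_const b" for a b
    by (simp add: bipoly_const_def)
  have one: "bipoly_const 1 = 1"
    by (simp add: bipoly_const_def one_pCons)
  fix a b :: real and x y :: bipoly
  show "bipoly_const a * (x + y) = bipoly_const a * x + bipoly_const a * y"
    by (rule distrib_left)
  show "bipoly_const (a + b) * x = bipoly_const a * x + bipoly_const b * x"
    by (simp only: add distrib_right)
  show "bipoly_const a * (bipoly_const b * x) = bipoly_const (a * b) * x"
    by (simp only: mult mult.assoc)
  show "bipoly_const 1 * x = x"
    by (simp only: one mult_1_left)
qed

definition growth_space :: "nat \<Rightarrow> (real \<times> real) set \<Rightarrow> bipoly set" where
  "growth_space d S =
     {p. \<exists>q. total_degree q \<le> 2 * d \<and> (\<forall>s\<in>S. (bipoly_eval p s)\<^sup>2 \<le> bipoly_eval q s)}"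

definition infinite_dimensional :: "bipoly set \<Rightarrow> bool" where
  "infinite_dimensional V \<longleftrightarrow> \<not> (\<exists>F. finite F \<and> bipoly.span F = V)"

definition S1 :: "(real \<times> real) set" where
  "S1 = {(a, b). 1 \<le> a \<and> 1 \<le> a ^ 3 * b + a ^ 6 - a \<and> a ^ 3 * b + a ^ 6 - a \<le> 2}"

definition S2 :: "(real \<times> real) set" where
  "S2 = {(a, b). 1 \<le> a \<and> 1 \<le> a ^ 3 * b - a ^ 6 - a \<and> a ^ 3 * b - a ^ 6 - a \<le> 2}"

end

theory Submission
  imports Defs "HOL-Computational_Algebra.Fundamental_Theorem_Algebra"
begin

text \<open>
  The set consists of the points \<open>(a, b)\<close> with \<open>b = e * a ^ 3 + (a + u) / a ^ 3\<close>, where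
  \<open>e = 1\<close> or \<open>e = -1\<close>, \<open>a \<ge> 1\<close> and \<open>1 \<le> u \<le> 2\<close>.

  Let \<open>p\<close> be bounded on it, of degree \<open>n\<close> in \<open>x2\<close>. For fixed \<open>a\<close> let \<open>z\<close> run through the complex
  roots of \<open>p(a, -)\<close> and choose \<open>u\<close> such that no root is closer than \<open>c / a ^ 3\<close> to the points of the
  two branches. As these points have distance \<open>2 * a ^ 3\<close>, the product of their distances to a root
  is at least \<open>c\<close>. Multiplying over all roots, the leading coefficient of \<open>p\<close> is bounded, hence
  constant, and every root is within \<open>O(1 / a ^ 3)\<close> of one of the two points. For large \<open>a\<close> both
  points attract equally many roots, so the roots add up to \<open>n / a\<^sup>2 + O(1 / a ^ 3)\<close>. But this sum is
  a polynomial in \<open>a\<close> by Vieta, whence \<open>n = 0\<close>.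

  For the second part, give \<open>x1\<close> weight 1 and \<open>x2\<close> weight 3. Restricted to the branches, a polynomial
  of weight at most \<open>6 * m\<close> becomes a Laurent polynomial in \<open>a\<close> with coefficients in \<open>\<real>[u]\<close>. It is
  \<open>O(a)\<close> as soon as the coefficients of all \<open>a\<^sup>k u\<^sup>l\<close> with \<open>k \<ge> 2\<close> vanish. These are
  \<open>6 * m\<^sup>2 + 4 * m\<close> linear conditions on \<open>6 * m\<^sup>2 + 5 * m + 1\<close> coefficients.
\<close>

section \<open>Parametrization of the set by two branches\<close>

text \<open>
  On \<open>S1\<close> (\<open>e = -1\<close>) and \<open>S2\<close> (\<open>e = 1\<close>), \<open>u\<close> is the value of the polynomial that the
  definition of the set confines to the interval from 1 to 2.
\<close>

definition branch :: "real \<Rightarrow> real \<Rightarrow> real \<Rightarrow> real" where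
  "branch e a u = e * a ^ 3 + (a + u) / a ^ 3"

lemma S1_Un_S2_eq:
  "S1 \<union> S2 = {(a, branch e a u) | e a u. e \<in> {1, -1} \<and> 1 \<le> a \<and> 1 \<le> u \<and> u \<le> 2}"
proof -
  have 1: "(a, b) \<in> S1 \<longleftrightarrow> 1 \<le> a \<and> (\<exists>u. 1 \<le> u \<and> u \<le> 2 \<and> b = branch (-1) a u)" for a b
  proof (cases "1 \<le> a")
    case True
    then have "b = branch (-1) a u \<longleftrightarrow> a ^ 3 * b + a ^ 6 - a = u" for u
      by (auto simp: branch_def field_simps power_add [symmetric])
    then show ?thesis using True by (auto simp: S1_def)
  qed (simp add: S1_def)
  have 2: "(a, b) \<in> S2 \<longleftrightarrow> 1 \<le> a \<and> (\<exists>u. 1 \<le> u \<and> u \<le> 2 \<and> b = branch 1 a u)" for a b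
  proof (cases "1 \<le> a")
    case True
    then have "b = branch 1 a u \<longleftrightarrow> a ^ 3 * b - a ^ 6 - a = u" for u
      by (auto simp: branch_def field_simps power_add [symmetric])
    then show ?thesis using True by (auto simp: S2_def)
  qed (simp add: S2_def)
  show ?thesis
  proof (intro set_eqI)
    fix s :: "real \<times> real"
    obtain a b where s: "s = (a, b)" by (cases s)
    show "s \<in> S1 \<union> S2 \<longleftrightarrow> s \<in> {(a, branch e a u) | e a u. e \<in> {1, -1} \<and> 1 \<le> a \<and> 1 \<le> u \<and> u \<le> 2}"
      unfolding s Un_iff 1 2 by blast
  qed
qed

section \<open>Evaluation, total degree and growth spaces\<close>

lemma bipoly_eval_0 [simp]: "bipoly_eval 0 s = 0"
  by (simp add: bipoly_eval_def)

lemma bipoly_eval_add [simp]: "bipoly_eval (p + q) s = bipoly_eval p s + bipoly_eval q s"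
  by (simp add: bipoly_eval_def)

lemma bipoly_eval_mult [simp]: "bipoly_eval (p * q) s = bipoly_eval p s * bipoly_eval q s"
  by (simp add: bipoly_eval_def)

lemma bipoly_eval_const [simp]: "bipoly_eval (bipoly_const c) s = c"
  by (simp add: bipoly_eval_def bipoly_const_def)

lemma bipoly_eval_sum: "bipoly_eval (sum f A) s = (\<Sum>x\<in>A. bipoly_eval (f x) s)"
  by (simp add: bipoly_eval_def poly_sum)

lemma bipoly_eval_monom: "bipoly_eval (monom (monom c i) j) (a, b) = c * a ^ i * b ^ j"
  by (simp add: bipoly_eval_def poly_monom poly_const_pow)

lemma total_degree_le_iff:
  "total_degree p \<le> n \<longleftrightarrow> (\<forall>i j. coeff (coeff p j) i \<noteq> 0 \<longrightarrow> i + j \<le> n)"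
  unfolding total_degree_def
  using finite_bipoly_support[of p]
  by (subst Max_le_iff) (auto simp: bipoly_support_def)

lemma total_degree_add_le:
  assumes "total_degree p \<le> n" "total_degree q \<le> n"
  shows "total_degree (p + q) \<le> n"
  using assms unfolding total_degree_le_iff
  by (metis add.right_neutral coeff_add)

lemma coeff_bipoly_const_mult:
  "coeff (coeff (bipoly_const c * p) j) i = c * coeff (coeff p j) i"
  by (simp add: bipoly_const_def)

lemma total_degree_const_mult_le:
  assumes "total_degree p \<le> n"
  shows "total_degree (bipoly_const c * p) \<le> n"
  using assms unfolding total_degree_le_iff coeff_bipoly_const_mult by auto

lemma total_degree_eq_0D:
  assumes "total_degree p = 0"
  shows "p = bipoly_const (coeff (coeff p 0) 0)"
proof -
  have z: "coeff (coeff p j) i = 0" if "i + j > 0" for i j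
    using assms total_degree_le_iff[of p 0] that by auto
  show ?thesis
    by (intro poly_eqI) (auto simp: z bipoly_const_def coeff_pCons split: nat.split)
qed

lemma total_degree_const: "total_degree (bipoly_const c) = 0"
  using total_degree_le_iff[of "bipoly_const c" 0]
  by (auto simp: bipoly_const_def coeff_pCons split: nat.splits if_splits)

lemma subspace_growth_space: "bipoly.subspace (growth_space d S)"
proof (rule bipoly.subspaceI)
  show "0 \<in> growth_space d S"
    by (auto simp: growth_space_def total_degree_le_iff intro!: exI[of _ 0])
next
  fix p p' assume "p \<in> growth_space d S" "p' \<in> growth_space d S"
  then obtain q q' where q: "total_degree q \<le> 2 * d" "total_degree q' \<le> 2 * d"
    and le: "\<And>s. s \<in> S \<Longrightarrow> (bipoly_eval p s)\<^sup>2 \<le> bipoly_eval q s"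
      "\<And>s. s \<in> S \<Longrightarrow> (bipoly_eval p' s)\<^sup>2 \<le> bipoly_eval q' s"
    by (auto simp: growth_space_def)
  \<comment> \<open>The factor 2 pays for the mixed term:
    \<open>(x + y)^2 \<le> 2 * (x^2 + y^2)\<close>.\<close>
  let ?q = "bipoly_const 2 * (q + q')"
  have "(bipoly_eval (p + p') s)\<^sup>2 \<le> bipoly_eval ?q s" if "s \<in> S" for s
  proof -
    have "(x + y)\<^sup>2 \<le> 2 * (x\<^sup>2 + y\<^sup>2)" for x y :: real
      using zero_le_power2[of "x - y"] by (simp add: power2_eq_square algebra_simps)
    then show ?thesis using le[OF that] by simp (smt (verit))
  qed
  moreover have "total_degree ?q \<le> 2 * d"
    by (intro total_degree_const_mult_le total_degree_add_le q)
  ultimately show "p + p' \<in> growth_space d S" by (auto simp: growth_space_def)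
next
  fix c p assume "p \<in> growth_space d S"
  then obtain q where q: "total_degree q \<le> 2 * d"
    and le: "\<And>s. s \<in> S \<Longrightarrow> (bipoly_eval p s)\<^sup>2 \<le> bipoly_eval q s"
    by (auto simp: growth_space_def)
  then have "(bipoly_eval (bipoly_const c * p) s)\<^sup>2 \<le> bipoly_eval (bipoly_const (c\<^sup>2) * q) s"
    if "s \<in> S" for s
    using that by (simp add: power_mult_distrib mult_left_mono)
  with q show "bipoly_const c * p \<in> growth_space d S"
    unfolding growth_space_def using total_degree_const_mult_le by blast
qed

section \<open>Growth of real polynomials in one variable\<close>

lemma poly_bounded_imp_degree_0:
  fixes P :: "real poly"
  assumes "\<And>a. a \<ge> a0 \<Longrightarrow> \<bar>poly P a\<bar> \<le> C"
  shows "degree P = 0"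
proof (rule ccontr)
  assume "degree P \<noteq> 0"
  then obtain c R where P: "P = pCons c R" and "R \<noteq> 0"
    by (cases P) (auto split: if_splits)
  from poly_infinity[OF \<open>R \<noteq> 0\<close>, of "C + 1" c] obtain r
    where r: "\<And>z. norm z \<ge> r \<Longrightarrow> C + 1 \<le> norm (poly P z)"
    unfolding P by blast
  have "C + 1 \<le> \<bar>poly P (max a0 \<bar>r\<bar>)\<bar>" using r[of "max a0 \<bar>r\<bar>"] by auto
  with assms[of "max a0 \<bar>r\<bar>"] show False by simp
qed

text \<open>Multiplied by \<open>a ^ 3\<close>, the bound says that
  \<open>a * (a^2 * P(a) - c)\<close> is bounded, hence constant. A multiple of the variable is
  constant only if it is zero, and the cofactor has the value \<open>- c\<close> at 0.\<close>

lemma poly_asymp_inverse_square: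
  fixes P :: "real poly"
  assumes "\<And>a. a \<ge> a0 \<Longrightarrow> \<bar>poly P a - c / a\<^sup>2\<bar> \<le> M / a ^ 3"
  shows "c = 0"
proof -
  define Q where "Q = monom 1 2 * P - [:c:]"
  define R where "R = pCons 0 Q"
  have eq: "poly R a = a ^ 3 * (poly P a - c / a\<^sup>2)" if "a \<noteq> 0" for a
    using that by (simp add: R_def Q_def poly_monom field_simps power2_eq_square power3_eq_cube)
  have "\<bar>poly R a\<bar> \<le> M" if "a \<ge> max a0 1" for a
  proof -
    have "a > 0" using that by simp
    then have "\<bar>poly R a\<bar> = a ^ 3 * \<bar>poly P a - c / a\<^sup>2\<bar>" by (simp add: eq abs_mult)
    also have "\<dots> \<le> a ^ 3 * (M / a ^ 3)"
      using assms[of a] that \<open>a > 0\<close> by (intro mult_left_mono) auto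
    finally show ?thesis using \<open>a > 0\<close> by simp
  qed
  then have "degree R = 0" by (rule poly_bounded_imp_degree_0)
  then have "Q = 0" by (auto simp: R_def split: if_splits)
  then have "poly Q 0 = 0" by simp
  then show ?thesis by (simp add: Q_def poly_monom)
qed

section \<open>Avoiding finitely many points; products over multisets\<close>

text \<open>One of the two outer quarters of the interval keeps distance at least
  \<open>d / 4\<close> from a given \<open>t\<close>; the induction continues inside that
  quarter.\<close>

lemma exists_far_point:
  fixes T :: "real multiset"
  assumes "d \<ge> 0"
  shows "\<exists>u\<in>{l..l + d}. \<forall>t\<in>#T. d / 4 ^ size T \<le> \<bar>u - t\<bar>"
  using assms
proof (induction T arbitrary: l d)
  case empty
  then show ?case by auto
next
  case (add t T)
  define l' where "l' = (if t \<ge> l + d / 2 then l else l + 3 * d / 4)"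
  obtain u where u: "u \<in> {l'..l' + d / 4}" "\<And>t'. t' \<in># T \<Longrightarrow> d / 4 / 4 ^ size T \<le> \<bar>u - t'\<bar>"
    using add.IH[of "d / 4" l'] add.prems by auto
  have "d / 4 / 4 ^ size T \<le> d / 4"
    using divide_left_mono[of 1 "4 ^ size T" "d / 4"] add.prems by simp
  moreover have "d / 4 \<le> \<bar>u - t\<bar>" "u \<in> {l..l + d}"
    using u(1) add.prems by (auto simp: l'_def split: if_splits)
  ultimately show ?case using u(2)
    by (intro bexI[of _ u]) (auto simp: mult.commute)
qed

lemma prod_mset_mono:
  fixes f g :: "'a \<Rightarrow> real"
  assumes "\<And>x. x \<in># A \<Longrightarrow> 0 \<le> f x \<and> f x \<le> g x"
  shows "0 \<le> (\<Prod>x\<in>#A. f x) \<and> (\<Prod>x\<in>#A. f x) \<le> (\<Prod>x\<in>#A. g x)"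
  using assms
proof (induction A)
  case (add x A)
  then have "0 \<le> (\<Prod>x\<in>#A. f x)" "(\<Prod>x\<in>#A. f x) \<le> (\<Prod>x\<in>#A. g x)" "0 \<le> f x" "f x \<le> g x"
    by auto
  then show ?case by (auto intro!: mult_mono)
qed simp

text \<open>The factors other than \<open>h z\<close> have a product of at least
  \<open>c ^ (size A - 1)\<close>, hence of at least \<open>c ^ size A\<close> because
  \<open>c \<le> 1\<close>.\<close>

lemma factor_le_of_prod_mset_le:
  fixes h :: "'a \<Rightarrow> real"
  assumes "\<And>x. x \<in># A \<Longrightarrow> c \<le> h x" "0 < c" "c \<le> 1" "(\<Prod>x\<in>#A. h x) \<le> K" "z \<in># A"
  shows "h z \<le> K / c ^ size A"
proof -
  obtain B where A: "A = add_mset z B" using assms(5) by (metis insert_DiffM)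
  have "(\<Prod>x\<in>#B. c) \<le> (\<Prod>x\<in>#B. h x)"
    using prod_mset_mono[of B "\<lambda>_. c" h] assms by (auto simp: A)
  then have le: "c ^ size B \<le> (\<Prod>x\<in>#B. h x)" by simp
  have "c ^ size A \<le> c ^ size B" using assms by (auto simp: A mult_le_cancel_right2)
  then have "h z * c ^ size A \<le> h z * (\<Prod>x\<in>#B. h x)"
    using le assms(1)[OF assms(5)] assms(2) by (intro mult_left_mono) auto
  also have "\<dots> \<le> K" using assms(4) by (simp add: A)
  finally show ?thesis using assms(2) by (simp add: field_simps)
qed

text \<open>Vieta for the two top coefficients. For empty \<open>A\<close>,
  \<open>size A - 1\<close> truncates to 0 and the coefficient there is 1, which is why this case is
  excluded.\<close>

lemma coeff_prod_linear:
  fixes A :: "'a :: idom multiset"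
  shows "degree (\<Prod>z\<in>#A. [:-z, 1:]) = size A \<and> coeff (\<Prod>z\<in>#A. [:-z, 1:]) (size A) = 1 \<and>
    (A \<noteq> {#} \<longrightarrow> coeff (\<Prod>z\<in>#A. [:-z, 1:]) (size A - 1) = - (\<Sum>z\<in>#A. z))"
proof (induction A)
  case (add z A)
  let ?Q = "\<Prod>z\<in>#A. [:-z, 1:]"
  have Q: "degree ?Q = size A" "coeff ?Q (size A) = 1"
    "A \<noteq> {#} \<Longrightarrow> coeff ?Q (size A - 1) = - (\<Sum>z\<in>#A. z)"
    using add.IH by auto
  then have "?Q \<noteq> 0" by auto
  then have "degree ([:-z, 1:] * ?Q) = Suc (size A)"
    by (subst degree_mult_eq) (auto simp: Q)
  moreover have "coeff ([:-z, 1:] * ?Q) (Suc (size A)) = 1"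
    using Q by (simp add: coeff_eq_0)
  moreover have "coeff ([:-z, 1:] * ?Q) (size A) = - (\<Sum>z\<in>#add_mset z A. z)"
  proof (cases "A = {#}")
    case False
    then obtain m where "size A = Suc m" by (cases "size A") auto
    then show ?thesis using Q False by (simp add: algebra_simps)
  qed simp
  ultimately show ?case by simp
qed simp

lemma poly_prod_linear:
  "poly (\<Prod>z\<in>#A. [:-z, 1:]) x = (\<Prod>z\<in>#A. x - z)"
  for x :: "'a :: idom"
  by (induction A) (auto simp: algebra_simps)

lemma norm_prod_mset:
  fixes f :: "'b \<Rightarrow> 'a::real_normed_field"
  shows "norm (\<Prod>x\<in>#A. f x) = (\<Prod>x\<in>#A. norm (f x))"
  by (induction A) (auto simp: norm_mult)

section \<open>Position of the roots relative to the two branches\<close>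

lemma branch_diff:
  "branch e a u - branch (- e) a u = 2 * e * a ^ 3"
  by (simp add: branch_def)

text \<open>\<open>g e z\<close> is the parameter at which branch \<open>e\<close> meets the real
  part of \<open>z\<close>; a distance \<open>c\<close> between parameters becomes
  \<open>c / a ^ 3\<close> on the branch. One \<open>u\<close> has to serve both branches, so
  \<open>2 * size A\<close> values are avoided, whence the exponent in \<open>c\<close>.\<close>

lemma exists_far_branch_point:
  fixes A :: "complex multiset"
  assumes "a \<ge> 1"
  defines "c \<equiv> 1 / 4 ^ (2 * size A) :: real"
  shows "\<exists>u\<in>{1..2}. \<forall>e\<in>{1, -1}. \<forall>z\<in>#A. c / a ^ 3 \<le> cmod (of_real (branch e a u) - z)"
proof -
  define g where "g e z = (Re z - e * a ^ 3) * a ^ 3 - a" for e z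
  define T where "T = image_mset (g 1) A + image_mset (g (-1)) A"
  have "size T = 2 * size A" by (simp add: T_def)
  then obtain u where u: "u \<in> {1..2}" and far: "\<And>t. t \<in># T \<Longrightarrow> c \<le> \<bar>u - t\<bar>"
    using exists_far_point[of 1 1 T] by (auto simp: c_def)
  have "c / a ^ 3 \<le> cmod (of_real (branch e a u) - z)" if "e \<in> {1, -1}" "z \<in># A" for e z
  proof -
    have "g e z \<in># T" using that by (auto simp: T_def)
    then have "c / a ^ 3 \<le> \<bar>u - g e z\<bar> / a ^ 3"
      using far assms by (intro divide_right_mono) auto
    also have "\<dots> = \<bar>(u - g e z) / a ^ 3\<bar>" using assms by (simp add: abs_divide)
    also have "(u - g e z) / a ^ 3 = Re (of_real (branch e a u) - z)"
      using assms by (simp add: g_def branch_def field_simps)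
    also have "\<bar>\<dots>\<bar> \<le> cmod (of_real (branch e a u) - z)" by (rule abs_Re_le_cmod)
    finally show ?thesis .
  qed
  with u show ?thesis by blast
qed

text \<open>The two points are \<open>2 * a ^ 3\<close> apart, so one of them is at least
  \<open>a ^ 3\<close> away from \<open>z\<close>, which makes up for the factor
  \<open>c / a ^ 3\<close> of the other. The sign \<open>d\<close> is that of the other one; it is
  an integer so that signs can be added up.\<close>

lemma norm_prod_branches_ge:
  assumes "a \<ge> 1" "0 < c" "c \<le> 1" "\<And>e. e \<in> {1, -1} \<Longrightarrow> c / a ^ 3 \<le> cmod (of_real (branch e a u) - z)"
  obtains d :: int where "d \<in> {1, -1}" "a ^ 3 \<le> cmod (of_real (branch (- of_int d) a u) - z)"
    "c \<le> cmod (of_real (branch 1 a u) - z) * cmod (of_real (branch (-1) a u) - z)"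
proof -
  let ?w = "\<lambda>e. cmod (of_real (branch e a u) - z)"
  have "2 * a ^ 3 = cmod ((of_real (branch 1 a u) - z) - (of_real (branch (-1) a u) - z))"
  proof -
    have "(of_real (branch 1 a u) - z) - (of_real (branch (-1) a u) - z) =
        complex_of_real (branch 1 a u - branch (-1) a u)" by simp
    also have "cmod \<dots> = 2 * a ^ 3"
      unfolding norm_of_real using branch_diff[of 1 a u] assms(1) by simp
    finally show ?thesis by (rule sym)
  qed
  also have "\<dots> \<le> ?w 1 + ?w (-1)" by (rule norm_triangle_ineq4)
  finally have "\<exists>d::int. d \<in> {1, -1} \<and> a ^ 3 \<le> ?w (- of_int d)"
    by (cases "a ^ 3 \<le> ?w 1") (force intro: exI[of _ "-1"] exI[of _ 1])+
  then obtain d :: int where d: "d \<in> {1, -1}" "a ^ 3 \<le> ?w (- of_int d)" by blast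
  have "c = (c / a ^ 3) * a ^ 3" using assms(1) by simp
  also have "\<dots> \<le> ?w (of_int d) * ?w (- of_int d)"
    using assms d by (intro mult_mono) auto
  also have "\<dots> = ?w 1 * ?w (-1)" using d(1) by auto
  finally show ?thesis using d that by blast
qed

text \<open>Multiplying the bounds on both branches at the same \<open>u\<close> pairs the distances
  of each root, and every pair contributes at least \<open>c\<close>. What remains does not depend
  on \<open>a\<close>.\<close>

lemma lead_coeff_bound:
  fixes A :: "complex multiset"
  assumes "a \<ge> 1" "L \<ge> 0"
    and bound: "\<And>e u. \<lbrakk>e \<in> {1, -1}; u \<in> {1..2}\<rbrakk> \<Longrightarrow> L * (\<Prod>z\<in>#A. cmod (of_real (branch e a u) - z)) \<le> C"
  shows "L\<^sup>2 * (1 / 4 ^ (2 * size A)) ^ size A \<le> C\<^sup>2"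
proof -
  define c where "c = (1 / 4 ^ (2 * size A) :: real)"
  have c: "0 < c" "c \<le> 1" by (simp_all add: c_def)
  let ?w = "\<lambda>e u z. cmod (of_real (branch e a u) - z)"
  obtain u where u: "u \<in> {1..2}" and
    far: "\<And>e z. \<lbrakk>e \<in> {1, -1}; z \<in># A\<rbrakk> \<Longrightarrow> c / a ^ 3 \<le> ?w e u z"
    using exists_far_branch_point[OF assms(1), of A] unfolding c_def by blast
  have "c ^ size A = (\<Prod>z\<in>#A. c)" by simp
  also have "\<dots> \<le> (\<Prod>z\<in>#A. ?w 1 u z * ?w (-1) u z)"
  proof (rule prod_mset_mono[THEN conjunct2])
    fix z assume "z \<in># A"
    from norm_prod_branches_ge[OF assms(1) c far[OF _ this]]
    show "0 \<le> c \<and> c \<le> ?w 1 u z * ?w (-1) u z" using c by auto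
  qed
  also have "\<dots> = (\<Prod>z\<in>#A. ?w 1 u z) * (\<Prod>z\<in>#A. ?w (-1) u z)" by (rule prod_mset.distrib)
  finally have "L\<^sup>2 * c ^ size A \<le> L\<^sup>2 * \<dots>" by (rule mult_left_mono) simp
  also have "\<dots> = (L * (\<Prod>z\<in>#A. ?w 1 u z)) * (L * (\<Prod>z\<in>#A. ?w (-1) u z))"
    by (simp add: power2_eq_square)
  also have "\<dots> \<le> C * C"
  proof (rule mult_mono[OF bound bound])
    have nn: "0 \<le> L * (\<Prod>z\<in>#A. ?w e u z)" for e
      using assms(2) prod_mset_mono[of A "\<lambda>_. 0" "?w e u"] prod_mset_mono[of A "?w e u" "?w e u"] by simp
    show "0 \<le> L * (\<Prod>z\<in>#A. ?w (-1) u z)" by (rule nn)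
    show "0 \<le> C" using nn[of 1] bound[of 1 u] u by simp
  qed (use u in auto)
  finally show ?thesis by (simp add: c_def power2_eq_square)
qed

text \<open>Replacing each root \<open>z\<close> by the point of branch \<open>d z\<close> costs
  \<open>K / a ^ 3\<close>. Once the signs \<open>d z\<close> cancel, the points add up to
  \<open>n * (a + u) / a ^ 3\<close>, which is \<open>n / a^2\<close> up to
  \<open>2 * n / a ^ 3\<close>.\<close>

lemma sum_roots_asymp:
  fixes A :: "complex multiset"
  assumes "a \<ge> 1" "L > 0"
    and bound: "\<And>e u. \<lbrakk>e \<in> {1, -1}; u \<in> {1..2}\<rbrakk> \<Longrightarrow> L * (\<Prod>z\<in>#A. cmod (of_real (branch e a u) - z)) \<le> C"
  defines "c \<equiv> 1 / 4 ^ (2 * size A) :: real"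
  assumes large: "a > C / (L * c ^ size A)"
  shows "cmod ((\<Sum>z\<in>#A. z) - of_real (size A / a\<^sup>2)) \<le>
           size A * ((C / L)\<^sup>2 / c ^ size A + 2) / a ^ 3"
proof -
  define n where "n = size A"
  define K where "K = (C / L)\<^sup>2 / c ^ n"
  have c: "0 < c" "c \<le> 1" by (simp_all add: c_def)
  let ?w = "\<lambda>e u z. cmod (of_real (branch e a u) - z)"
  obtain u where u: "u \<in> {1..2}" and
    far: "\<And>e z. \<lbrakk>e \<in> {1, -1}; z \<in># A\<rbrakk> \<Longrightarrow> c / a ^ 3 \<le> ?w e u z"
    using exists_far_branch_point[OF assms(1), of A] unfolding c_def by blast
  have nn: "0 \<le> (\<Prod>z\<in>#A. ?w e u z)" for e
    using prod_mset_mono[of A "?w e u" "?w e u"] by simp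
  have bound': "(\<Prod>z\<in>#A. ?w e u z) \<le> C / L" if "e \<in> {1, -1}" for e
    using bound[OF that u] assms(2) by (simp add: field_simps)
  have "\<exists>d::int. d \<in> {1, -1} \<and> a ^ 3 \<le> ?w (- of_int d) u z" if "z \<in># A" for z
    using norm_prod_branches_ge[OF assms(1) c far[OF _ that]] by blast
  then obtain d :: "complex \<Rightarrow> int"
    where d: "\<And>z. z \<in># A \<Longrightarrow> d z \<in> {1, -1} \<and> a ^ 3 \<le> ?w (- of_int (d z)) u z"
    by metis
  define D where "D = (\<Sum>z\<in>#A. d z)"

  \<comment> \<open>All pair products are at least \<open>c\<close> and their product is at most
    \<open>(C / L)^2\<close>, so each is at most \<open>K\<close>; the far point takes up a factor
    \<open>a ^ 3\<close> of it.\<close>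
  have near: "?w (of_int (d z)) u z \<le> K / a ^ 3" if z: "z \<in># A" for z
  proof -
    have "(\<Prod>z\<in>#A. ?w 1 u z * ?w (-1) u z) = (\<Prod>z\<in>#A. ?w 1 u z) * (\<Prod>z\<in>#A. ?w (-1) u z)"
      by (rule prod_mset.distrib)
    also have "\<dots> \<le> (C / L) * (C / L)"
      using bound' nn order.trans[OF nn bound', of 1] by (intro mult_mono) auto
    finally have "(\<Prod>z\<in>#A. ?w 1 u z * ?w (-1) u z) \<le> (C / L)\<^sup>2" by (simp only: power2_eq_square)
    moreover have "c \<le> ?w 1 u z * ?w (-1) u z" if "z \<in># A" for z
      using norm_prod_branches_ge[OF assms(1) c far[OF _ that]] by blast
    ultimately have "?w 1 u z * ?w (-1) u z \<le> K"
      unfolding K_def n_def using c z by (intro factor_le_of_prod_mset_le)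
    moreover have "?w 1 u z * ?w (-1) u z = ?w (of_int (d z)) u z * ?w (- of_int (d z)) u z"
      using d[OF z] by auto
    moreover have "?w (of_int (d z)) u z * a ^ 3 \<le> ?w (of_int (d z)) u z * ?w (- of_int (d z)) u z"
      using d[OF z] by (intro mult_left_mono) auto
    ultimately show ?thesis using assms(1) by (simp add: field_simps)
  qed

  \<comment> \<open>Real exponents cover both signs, so the product over the roots collects the
    signs into one power of \<open>a\<close>.\<close>
  have prod_powr: "(\<Prod>z\<in>#B. c * a powr (3 * of_int (e * d z))) =
      c ^ size B * a powr (3 * of_int (e * (\<Sum>z\<in>#B. d z)))" for B e
    using assms(1) by (induction B) (auto simp: powr_add [symmetric] algebra_simps)
  \<comment> \<open>An unequal number of roots near the two branches would make the product at least
    of order \<open>a ^ 3\<close> on one of them.\<close>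
  have "D = 0"
  proof (rule ccontr)
    assume "D \<noteq> 0"
    \<comment> \<open>Branch \<open>- e\<close> is the one with fewer roots assigned: a root with
      \<open>d z = e\<close> is at least \<open>a ^ 3\<close> away from it, any other at least
      \<open>c / a ^ 3\<close>. Of the resulting exponent \<open>3 * e * D\<close> only 1 is needed
      to contradict \<open>large\<close>.\<close>
    define e :: int where "e = sgn D"
    have e: "e \<in> {1, -1}" "e * D \<ge> 1" using \<open>D \<noteq> 0\<close> by (auto simp: e_def sgn_if)
    have "c ^ n * a powr (3 * of_int (e * D)) = (\<Prod>z\<in>#A. c * a powr (3 * of_int (e * d z)))"
      by (simp only: prod_powr D_def n_def)
    also have "\<dots> \<le> (\<Prod>z\<in>#A. ?w (- of_int e) u z)"
    proof (rule prod_mset_mono[THEN conjunct2])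
      fix z assume z: "z \<in># A"
      have a3: "a powr 3 = a ^ 3" "a powr - 3 = inverse (a ^ 3)"
        using assms(1) by (auto simp: powr_minus)
      have "c * a powr (3 * of_int (e * d z)) \<le> ?w (- of_int e) u z"
      proof (cases "d z = e")
        case True
        have "c * a ^ 3 \<le> a ^ 3" using c assms(1) by simp
        with True d[OF z] e show ?thesis by (auto simp: a3)
      next
        case False
        with d[OF z] e have "d z = - e" by auto
        with far[of "- of_int e", OF _ z] e show ?thesis by (auto simp: a3 divide_inverse)
      qed
      then show "0 \<le> c * a powr (3 * of_int (e * d z)) \<and>
          c * a powr (3 * of_int (e * d z)) \<le> ?w (- of_int e) u z" using c by simp
    qed
    also have "\<dots> \<le> C / L" using e by (intro bound') auto
    finally have "c ^ n * a powr (3 * of_int (e * D)) \<le> C / L" .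
    moreover have "a powr 1 \<le> a powr (3 * of_int (e * D))"
      using assms(1) e(2) by (intro powr_mono) linarith+
    then have "c ^ n * a \<le> c ^ n * a powr (3 * of_int (e * D))"
      using c assms(1) by (intro mult_left_mono) auto
    ultimately have "c ^ n * a \<le> C / L" by linarith
    with large show False using c assms(2) by (simp add: n_def field_simps)
  qed

  have sum_near: "(\<forall>z\<in>#B. ?w (of_int (d z)) u z \<le> K / a ^ 3) \<Longrightarrow>
      cmod ((\<Sum>z\<in>#B. z) - of_real (\<Sum>z\<in>#B. branch (of_int (d z)) a u)) \<le> size B * (K / a ^ 3)" for B
  proof (induction B)
    case (add z B)
    let ?b = "\<lambda>z. branch (of_int (d z)) a u"
    have "(\<Sum>z\<in>#add_mset z B. z) - of_real (\<Sum>z\<in>#add_mset z B. ?b z) =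
        ((\<Sum>z\<in>#B. z) - of_real (\<Sum>z\<in>#B. ?b z)) - (of_real (?b z) - z)"
      by (simp add: algebra_simps)
    then have "cmod ((\<Sum>z\<in>#add_mset z B. z) - of_real (\<Sum>z\<in>#add_mset z B. ?b z)) \<le>
        cmod ((\<Sum>z\<in>#B. z) - of_real (\<Sum>z\<in>#B. ?b z)) + ?w (of_int (d z)) u z"
      by (metis norm_triangle_ineq4)
    also have "\<dots> \<le> size B * (K / a ^ 3) + K / a ^ 3"
      using add by (intro add_mono) auto
    finally show ?case by (simp add: algebra_simps add_divide_distrib)
  qed simp
  have "(\<Sum>z\<in>#B. branch (of_int (d z)) a u) =
      of_int (\<Sum>z\<in>#B. d z) * a ^ 3 + size B * ((a + u) / a ^ 3)" for B
    by (induction B) (simp_all add: branch_def algebra_simps add_divide_distrib)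
  then have "(\<Sum>z\<in>#A. branch (of_int (d z)) a u) = n * ((a + u) / a ^ 3)"
    using \<open>D = 0\<close> by (simp add: D_def n_def)
  also have "\<dots> = n / a\<^sup>2 + n * u / a ^ 3"
    using assms(1) by (simp add: field_simps power2_eq_square power3_eq_cube)
  finally have "cmod ((\<Sum>z\<in>#A. z) - of_real (n / a\<^sup>2 + n * u / a ^ 3)) \<le> n * (K / a ^ 3)"
    using sum_near[of A] near by (auto simp: n_def)
  moreover have "cmod (of_real (n * u / a ^ 3)) \<le> n * 2 / a ^ 3"
    unfolding norm_of_real using u assms(1) by (auto simp: abs_mult abs_divide intro!: divide_right_mono mult_left_mono)
  moreover have "(\<Sum>z\<in>#A. z) - of_real (n / a\<^sup>2) =
      ((\<Sum>z\<in>#A. z) - of_real (n / a\<^sup>2 + n * u / a ^ 3)) + of_real (n * u / a ^ 3)"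
    by simp
  ultimately have "cmod ((\<Sum>z\<in>#A. z) - of_real (n / a\<^sup>2)) \<le> n * (K / a ^ 3) + n * 2 / a ^ 3"
    by (simp only: norm_triangle_mono)
  then show ?thesis by (simp add: n_def K_def ring_distribs add_divide_distrib)
qed

section \<open>Bounded polynomials are constant\<close>

lemma growth_space_0_subset: "growth_space 0 (S1 \<union> S2) \<subseteq> range bipoly_const"
proof
  fix p assume "p \<in> growth_space 0 (S1 \<union> S2)"
  then obtain q where "total_degree q = 0" and
    q: "\<And>s. s \<in> S1 \<union> S2 \<Longrightarrow> (bipoly_eval p s)\<^sup>2 \<le> bipoly_eval q s"
    by (auto simp: growth_space_def)
  then obtain K where K: "q = bipoly_const K" using total_degree_eq_0D by blast
  define C where "C = sqrt K"
  have bounded: "\<bar>bipoly_eval p (a, branch e a u)\<bar> \<le> C"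
    if "e \<in> {1, -1}" "a \<ge> 1" "u \<in> {1..2}" for a e u
  proof -
    have "(a, branch e a u) \<in> S1 \<union> S2" unfolding S1_Un_S2_eq using that by auto
    from q[OF this] show ?thesis by (simp add: K C_def real_le_rsqrt)
  qed
  define n where "n = degree p"
  define c where "c = (1 / 4 ^ (2 * n) :: real)"
  have c: "0 < c" by (simp add: c_def)
  \<comment> \<open>\<open>P a\<close> is \<open>p(a, -)\<close> over the complex numbers, where it
    splits into linear factors.\<close>
  define P where "P a = map_poly (\<lambda>g. complex_of_real (poly g a)) p" for a
  have coeff_P: "coeff (P a) j = of_real (poly (coeff p j) a)" for a j
    by (simp add: P_def coeff_map_poly)
  have eval_P: "poly (P a) (of_real b) = of_real (bipoly_eval p (a, b))" for a b
    unfolding P_def bipoly_eval_def by (induction p) (auto simp: map_poly_pCons)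
  have roots: "\<exists>A. size A = n \<and> P a = smult (of_real (poly (lead_coeff p) a)) (\<Prod>z\<in>#A. [:-z, 1:]) \<and>
      (\<forall>e\<in>{1, -1}. \<forall>u\<in>{1..2}. \<bar>poly (lead_coeff p) a\<bar> *
         (\<Prod>z\<in>#A. cmod (of_real (branch e a u) - z)) \<le> C)"
    if "a \<ge> 1" "poly (lead_coeff p) a \<noteq> 0" for a
  proof -
    have "degree (P a) = n"
    proof (rule antisym)
      show "degree (P a) \<le> n" by (rule degree_le) (simp add: coeff_P n_def coeff_eq_0)
      show "n \<le> degree (P a)" using that(2) by (intro le_degree) (simp add: coeff_P n_def)
    qed
    moreover from this have "P a \<noteq> 0" using that(2) coeff_P[of a n] by (auto simp: n_def)
    ultimately obtain A where A: "size A = n"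
      "P a = smult (of_real (poly (lead_coeff p) a)) (\<Prod>z\<in>#A. [:-z, 1:])"
      using alg_closed_imp_factorization[of "P a"] coeff_P[of a n] by (auto simp: n_def)
    have "\<bar>poly (lead_coeff p) a\<bar> * (\<Prod>z\<in>#A. cmod (of_real b - z)) = \<bar>bipoly_eval p (a, b)\<bar>" for b
    proof -
      have "\<bar>bipoly_eval p (a, b)\<bar> = cmod (poly (P a) (of_real b))"
        by (simp add: eval_P)
      then show ?thesis by (simp add: A(2) poly_prod_linear norm_mult norm_prod_mset)
    qed
    with A bounded[OF _ that(1)] show ?thesis by auto
  qed

  have "degree (lead_coeff p) = 0"
  proof (rule poly_bounded_imp_degree_0)
    fix a :: real assume a: "a \<ge> 1"
    \<comment> \<open>The bound is \<open>lead_coeff_bound\<close> solved for the leading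
      coefficient. Where the latter vanishes, \<open>roots\<close> does not apply, but the bound is
      trivial.\<close>
    show "\<bar>poly (lead_coeff p) a\<bar> \<le> sqrt (C\<^sup>2 / c ^ n)"
    proof (cases "poly (lead_coeff p) a = 0")
      case False
      obtain A where A: "size A = n" "\<And>e u. \<lbrakk>e \<in> {1, -1}; u \<in> {1..2}\<rbrakk> \<Longrightarrow>
          \<bar>poly (lead_coeff p) a\<bar> * (\<Prod>z\<in>#A. cmod (of_real (branch e a u) - z)) \<le> C"
        using roots[OF a False] by blast
      from lead_coeff_bound[OF a _ A(2)] A(1) have "\<bar>poly (lead_coeff p) a\<bar>\<^sup>2 * c ^ n \<le> C\<^sup>2"
        by (simp add: c_def)
      then show ?thesis using c by (intro real_le_rsqrt) (simp add: field_simps)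
    qed (use c in simp)
  qed
  then obtain l where l: "lead_coeff p = [:l:]" by (meson degree_eq_zeroE)

  have "n = 0"
  proof (rule ccontr)
    assume "n \<noteq> 0"
    then have "l \<noteq> 0" using l by (auto simp: n_def)
    define M where "M = n * ((C / \<bar>l\<bar>)\<^sup>2 / c ^ n + 2)"
    \<comment> \<open>By Vieta \<open>Q\<close> is the sum of the roots of \<open>P a\<close> as a
      function of \<open>a\<close>. It is a polynomial because the leading coefficient is the
      constant \<open>l\<close>.\<close>
    define Q where "Q = smult (- 1 / l) (coeff p (n - 1))"
    have "\<bar>poly Q a - n / a\<^sup>2\<bar> \<le> M / a ^ 3" if "a \<ge> max 1 (C / (\<bar>l\<bar> * c ^ n) + 1)" for a
    proof -
      have a: "a \<ge> 1" "a > C / (\<bar>l\<bar> * c ^ n)" using that by auto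
      obtain A where A: "size A = n" "P a = smult (of_real l) (\<Prod>z\<in>#A. [:-z, 1:])"
        "\<And>e u. \<lbrakk>e \<in> {1, -1}; u \<in> {1..2}\<rbrakk> \<Longrightarrow>
          \<bar>l\<bar> * (\<Prod>z\<in>#A. cmod (of_real (branch e a u) - z)) \<le> C"
        using roots[OF a(1)] \<open>l \<noteq> 0\<close> unfolding l poly_pCons by (metis mult_zero_right add_0_right poly_0)
      have "coeff (P a) (n - 1) = - of_real l * (\<Sum>z\<in>#A. z)"
        using coeff_prod_linear[of A] A(1) \<open>n \<noteq> 0\<close> by (auto simp: A(2))
      then have "(\<Sum>z\<in>#A. z) = of_real (poly Q a)"
        using \<open>l \<noteq> 0\<close> by (simp add: coeff_P Q_def field_simps)
      moreover have "cmod ((\<Sum>z\<in>#A. z) - of_real (size A / a\<^sup>2)) \<le> M / a ^ 3"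
        using sum_roots_asymp[OF a(1) _ A(3)] a(2) \<open>l \<noteq> 0\<close> by (simp add: A(1) M_def c_def)
      ultimately have "cmod (of_real (poly Q a - n / a\<^sup>2)) \<le> M / a ^ 3"
        by (simp add: A(1))
      then show ?thesis unfolding norm_of_real .
    qed
    then have "real n = 0" by (rule poly_asymp_inverse_square)
    with \<open>n \<noteq> 0\<close> show False by simp
  qed
  then have "p = bipoly_const l"
    using l unfolding n_def bipoly_const_def by (metis degree_0_id)
  then show "p \<in> range bipoly_const" by simp
qed

lemma bipoly_const_in_growth_space: "bipoly_const c \<in> growth_space d S"
  unfolding growth_space_def
  by (intro CollectI exI[of _ "bipoly_const (c\<^sup>2)"]) (simp add: total_degree_const)

section \<open>Linear systems; counting monomials and conditions\<close>

text \<open>Gaussian elimination: equation \<open>b\<close> is solved for the unknown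
  \<open>a0\<close> with nonzero entry, and \<open>M'\<close> is the system left after substitution.
  A solution of \<open>M'\<close> extends by the value \<open>s\<close> at
  \<open>a0\<close>.\<close>

lemma exists_nontrivial_solution:
  fixes M :: "'b \<Rightarrow> 'a \<Rightarrow> 'c :: field"
  assumes "finite B" "finite A" "card B < card A"
  shows "\<exists>c. (\<exists>a\<in>A. c a \<noteq> 0) \<and> (\<forall>b\<in>B. (\<Sum>a\<in>A. c a * M b a) = 0)"
  using assms
proof (induction B arbitrary: A M rule: finite_induct)
  case empty
  then show ?case by (intro exI[of _ "\<lambda>_. 1"]) (auto simp: card_gt_0_iff)
next
  case (insert b B)
  show ?case
  proof (cases "\<forall>a\<in>A. M b a = 0")
    case True
    with insert.IH[of A M] insert show ?thesis by auto
  next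
    case False
    then obtain a0 where a0: "a0 \<in> A" "M b a0 \<noteq> 0" by blast
    define A' where "A' = A - {a0}"
    have A: "A = insert a0 A'" "a0 \<notin> A'" "finite A'" using a0 insert.prems by (auto simp: A'_def)
    define M' where "M' b' a = M b' a - M b' a0 * M b a / M b a0" for b' a
    have "card B < card A'" using insert A by simp
    then obtain c where c: "\<exists>a\<in>A'. c a \<noteq> 0" "\<And>b'. b' \<in> B \<Longrightarrow> (\<Sum>a\<in>A'. c a * M' b' a) = 0"
      using insert.IH[of A' M'] A(3) by blast
    define s where "s = - (\<Sum>a\<in>A'. c a * M b a) / M b a0"
    let ?c = "c(a0 := s)"
    have sum: "(\<Sum>a\<in>A. ?c a * M b' a) = s * M b' a0 + (\<Sum>a\<in>A'. c a * M b' a)" for b'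
      unfolding A(1) using A(2,3) by (simp, intro sum.cong) auto
    have "(\<Sum>a\<in>A. ?c a * M b' a) = 0" if "b' \<in> insert b B" for b'
    proof (cases "b' = b")
      case True
      have "s * M b a0 = - (\<Sum>a\<in>A'. c a * M b a)" using a0 by (simp add: s_def)
      then show ?thesis unfolding True sum by simp
    next
      case False
      have "(\<Sum>a\<in>A'. c a * M' b' a) =
          (\<Sum>a\<in>A'. c a * M b' a) - (\<Sum>a\<in>A'. c a * M b a) * M b' a0 / M b a0"
        by (simp add: M'_def algebra_simps sum_subtractf sum_distrib_left sum_divide_distrib)
      then show ?thesis using c(2)[of b'] False that unfolding sum by (simp add: s_def)
    qed
    moreover have "\<exists>a\<in>A. ?c a \<noteq> 0" using c(1) A by auto
    ultimately show ?thesis by blast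
  qed
qed

definition monomials :: "nat \<Rightarrow> (nat \<times> nat) set" where
  "monomials N = {(i, j). i + 3 * j \<le> N}"

text \<open>
  The triple \<open>(e, k, l)\<close> stands for the coefficient of \<open>a\<^sup>k u\<^sup>l\<close> on the branch \<open>e\<close>. A power
  \<open>u\<^sup>l\<close> costs at least a factor \<open>a ^ (6 * l)\<close> against the leading term, since \<open>u\<close> enters a branch
  as \<open>u / a ^ 3\<close> and replaces \<open>e * a ^ 3\<close>.
\<close>

definition obstructions :: "nat \<Rightarrow> (real \<times> int \<times> nat) set" where
  "obstructions N = {1, -1} \<times> {(k, l). 2 \<le> k \<and> k + 6 * int l \<le> int N}"

lemma finite_monomials: "finite (monomials N)"
  by (rule finite_subset[of _ "{..N} \<times> {..N}"]) (auto simp: monomials_def)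

lemma finite_obstructions: "finite (obstructions N)"
  by (rule finite_subset[of _ "{1, -1} \<times> {2..int N} \<times> {..N}"]) (auto simp: obstructions_def)

lemma card_monomials: "card (monomials (6 * m)) = 6 * m\<^sup>2 + 5 * m + 1"
proof -
  have eq: "monomials (6 * m) = prod.swap ` (SIGMA j:{..2 * m}. {..6 * m - 3 * j})"
    by (force simp: monomials_def image_def)
  \<comment> \<open>Doubled and over the integers, the formula holds for every \<open>k\<close>,
    without halving or truncated subtraction.\<close>
  have sum: "2 * (\<Sum>j\<le>k. 6 * int m + 1 - 3 * int j) = (int k + 1) * (2 * (6 * int m + 1) - 3 * int k)" for k
    by (induction k) (auto simp: algebra_simps)
  have "int (\<Sum>j\<le>2 * m. Suc (6 * m - 3 * j)) = (\<Sum>j\<le>2 * m. 6 * int m + 1 - 3 * int j)"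
    unfolding of_nat_sum by (intro sum.cong) auto
  also have "\<dots> = int (6 * m\<^sup>2 + 5 * m + 1)"
    using sum[of "2 * m"] by (simp add: algebra_simps power2_eq_square)
  finally have "(\<Sum>j\<le>2 * m. Suc (6 * m - 3 * j)) = 6 * m\<^sup>2 + 5 * m + 1" by (simp only: of_nat_eq_iff)
  then show ?thesis unfolding eq
    by (auto simp: card_image)
qed

text \<open>This is \<open>m + 1\<close> less than the number of monomials, a gap that grows without
  bound. The slices end at \<open>l < m\<close> since \<open>l = m\<close> would force
  \<open>k \<le> 0\<close>.\<close>

lemma card_obstructions:
  "card (obstructions (6 * m)) = 6 * m\<^sup>2 + 4 * m"
proof -
  have eq: "{(k, l). 2 \<le> k \<and> k + 6 * int l \<le> int (6 * m)} =
      prod.swap ` (SIGMA l:{..<m}. {2..6 * int m - 6 * int l})"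
    by (force simp: image_def)
  have sum: "(\<Sum>l<k. 6 * int m - 6 * int l - 1) = 6 * int m * int k - 3 * int k * (int k - 1) - int k" for k
    by (induction k) (auto simp: algebra_simps)
  have "int (\<Sum>l<m. nat (6 * int m - 6 * int l - 1)) = (\<Sum>l<m. 6 * int m - 6 * int l - 1)"
    unfolding of_nat_sum by (intro sum.cong) auto
  also have "\<dots> = int (3 * m\<^sup>2 + 2 * m)"
    unfolding sum by (simp add: algebra_simps power2_eq_square)
  finally have "(\<Sum>l<m. nat (6 * int m - 6 * int l - 1)) = 3 * m\<^sup>2 + 2 * m" by (simp only: of_nat_eq_iff)
  then show ?thesis unfolding obstructions_def eq
    by (auto simp: card_image card_cartesian_product)
qed

section \<open>Expansion of polynomials on the branches\<close>

text \<open>Indices of the twofold binomial expansion of \<open>x2 ^ j\<close>: \<open>m\<close>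
  factors contribute \<open>(a + u) / a ^ 3\<close>, and \<open>l\<close> of these contribute the
  \<open>u\<close>.\<close>

definition branch_terms :: "nat \<times> nat \<Rightarrow> (nat \<times> nat) set" where
  "branch_terms = (\<lambda>(i, j). SIGMA m:{..j}. {..m})"

definition branch_coeff :: "real \<Rightarrow> nat \<times> nat \<Rightarrow> nat \<times> nat \<Rightarrow> real" where
  "branch_coeff e = (\<lambda>(i, j) (m, l). real (j choose m) * real (m choose l) * e ^ (j - m))"

definition branch_exp :: "nat \<times> nat \<Rightarrow> nat \<times> nat \<Rightarrow> int \<times> nat" where
  "branch_exp = (\<lambda>(i, j) (m, l). (int i + 3 * int j - 5 * int m - int l, l))"

text \<open>The matrix of the linear system: its row is a condition, its column a monomial.\<close>

definition obstruction_coeff :: "real \<times> int \<times> nat \<Rightarrow> nat \<times> nat \<Rightarrow> real" where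
  "obstruction_coeff = (\<lambda>(e, y) x. \<Sum>t | t \<in> branch_terms x \<and> branch_exp x t = y. branch_coeff e x t)"

definition bipoly_of :: "(nat \<times> nat) set \<Rightarrow> (nat \<times> nat \<Rightarrow> real) \<Rightarrow> bipoly" where
  "bipoly_of E c = (\<Sum>(i, j)\<in>E. monom (monom (c (i, j)) i) j)"

lemma finite_branch_terms [simp]: "finite (branch_terms x)"
  by (cases x) (simp add: branch_terms_def)

lemma coeff_bipoly_of:
  assumes "finite E"
  shows "coeff (coeff (bipoly_of E c) j) i = (if (i, j) \<in> E then c (i, j) else 0)"
proof -
  have "coeff (coeff (bipoly_of E c) j) i = (\<Sum>x\<in>E. if x = (i, j) then c x else 0)"
    unfolding bipoly_of_def coeff_sum split_def by (intro sum.cong) (auto simp: coeff_monom split: if_splits)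
  with assms show ?thesis by simp
qed

lemma monomial_on_branch:
  assumes "a \<noteq> 0"
  shows "a ^ i * branch e a u ^ j = (\<Sum>t\<in>branch_terms (i, j).
    branch_coeff e (i, j) t * (u ^ snd (branch_exp (i, j) t) * a powi fst (branch_exp (i, j) t)))"
proof -
  have pw: "a ^ i * ((a ^ (m - l) / (a ^ 3) ^ m) * (a ^ 3) ^ (j - m)) =
      a powi (int i + 3 * int j - 5 * int m - int l)" if "l \<le> m" "m \<le> j" for m l
  proof -
    have "int i + 3 * int j - 5 * int m - int l =
        int i + (int (m - l) - int (3 * m) + int (3 * (j - m)))" using that by simp
    then have "a powi (int i + 3 * int j - 5 * int m - int l) =
        a powi int i * (a powi int (m - l) / a powi int (3 * m) * a powi int (3 * (j - m)))"
      using power_int_add[of a "int i" "int (m - l) - int (3 * m) + int (3 * (j - m))"]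
        power_int_add[of a "int (m - l) - int (3 * m)" "int (3 * (j - m))"]
        power_int_diff[of a "int (m - l)" "int (3 * m)"] assms by presburger
    then show ?thesis by (simp only: power_int_of_nat power_mult)
  qed
  have "a ^ i * branch e a u ^ j = a ^ i * ((u + a) / a ^ 3 + e * a ^ 3) ^ j"
    by (simp add: branch_def add.commute)
  also have "\<dots> = (\<Sum>m\<le>j. \<Sum>l\<le>m. real (j choose m) * real (m choose l) * e ^ (j - m) *
      (u ^ l * (a ^ i * ((a ^ (m - l) / (a ^ 3) ^ m) * (a ^ 3) ^ (j - m)))))"
    unfolding binomial_ring[of "(u + a) / a ^ 3"] sum_distrib_left
  proof (rule sum.cong [OF refl])
    fix m
    have "((u + a) / a ^ 3) ^ m = (\<Sum>l\<le>m. real (m choose l) * u ^ l * a ^ (m - l)) / (a ^ 3) ^ m"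
      unfolding power_divide binomial_ring[of u a] by simp
    then show "a ^ i * (real (j choose m) * ((u + a) / a ^ 3) ^ m * (e * a ^ 3) ^ (j - m)) =
        (\<Sum>l\<le>m. real (j choose m) * real (m choose l) * e ^ (j - m) *
          (u ^ l * (a ^ i * ((a ^ (m - l) / (a ^ 3) ^ m) * (a ^ 3) ^ (j - m)))))"
      by (simp only: power_mult_distrib sum_distrib_left sum_distrib_right sum_divide_distrib
        times_divide_eq_left times_divide_eq_right mult_ac)
  qed
  also have "\<dots> = (\<Sum>m\<le>j. \<Sum>l\<le>m. real (j choose m) * real (m choose l) * e ^ (j - m) *
      (u ^ l * a powi (int i + 3 * int j - 5 * int m - int l)))"
    by (intro sum.cong refl) (simp only: pw atMost_iff)
  finally show ?thesis
    by (simp add: branch_terms_def branch_coeff_def branch_exp_def sum.Sigma split_def)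
qed

lemma bipoly_of_on_branch:
  assumes "finite E" "a \<noteq> 0"
  shows "bipoly_eval (bipoly_of E c) (a, branch e a u) =
    (\<Sum>(x, t)\<in>Sigma E branch_terms. c x * branch_coeff e x t *
       (u ^ snd (branch_exp x t) * a powi fst (branch_exp x t)))"
proof -
  have "bipoly_eval (bipoly_of E c) (a, branch e a u) =
      (\<Sum>(i, j)\<in>E. c (i, j) * (a ^ i * branch e a u ^ j))"
    by (simp add: bipoly_of_def bipoly_eval_sum bipoly_eval_monom split_def mult.assoc)
  also have "\<dots> = (\<Sum>x\<in>E. \<Sum>t\<in>branch_terms x. c x * branch_coeff e x t *
       (u ^ snd (branch_exp x t) * a powi fst (branch_exp x t)))"
    by (intro sum.cong refl)
      (auto simp only: monomial_on_branch[OF assms(2)] sum_distrib_left mult.assoc split: prod.split)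
  also have "\<dots> = (\<Sum>(x, t)\<in>Sigma E branch_terms. c x * branch_coeff e x t *
       (u ^ snd (branch_exp x t) * a powi fst (branch_exp x t)))"
    using assms(1) by (intro sum.Sigma) auto
  finally show ?thesis .
qed

text \<open>The exponent drops by \<open>5 * m + l\<close>, which is at least \<open>6 * l\<close>
  because \<open>l \<le> m\<close>.\<close>

lemma branch_exp_le:
  assumes "x \<in> monomials N" "t \<in> branch_terms x" "branch_exp x t = (k, l)"
  shows "k + 6 * int l \<le> int N"
  using assms by (auto simp: monomials_def branch_terms_def branch_exp_def)

text \<open>Terms with exponent at least 2 cancel when grouped by the powers of \<open>a\<close> and
  \<open>u\<close>. The others have exponent at most 1, so \<open>a \<ge> 1\<close> and
  \<open>u \<le> 2\<close> bound them by a multiple of \<open>a\<close>.\<close>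

lemma bipoly_of_bounded_on_branch:
  assumes zero: "\<And>y. y \<in> obstructions N \<Longrightarrow> (\<Sum>x\<in>monomials N. c x * obstruction_coeff y x) = 0"
    and e: "e \<in> {1, -1}"
  obtains C where
    "\<And>a u. \<lbrakk>a \<ge> 1; u \<in> {1..2}\<rbrakk> \<Longrightarrow> \<bar>bipoly_eval (bipoly_of (monomials N) c) (a, branch e a u)\<bar> \<le> C * a"
proof -
  let ?X = "Sigma (monomials N) branch_terms"
  define g where "g = (\<lambda>(x, t). branch_exp x t)"
  define w where "w = (\<lambda>(x, t). c x * branch_coeff e x t)"
  define hi where "hi = {x \<in> ?X. fst (g x) \<ge> 2}"
  define lo where "lo = {x \<in> ?X. fst (g x) < 2}"
  have fin: "finite ?X" "finite hi" "finite lo"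
    by (auto simp: hi_def lo_def finite_monomials)
  define Y where "Y = {y. (e, y) \<in> obstructions N}"
  have "finite Y"
    by (rule finite_subset[of _ "snd ` obstructions N"]) (force simp: Y_def finite_obstructions)+
  define C where "C = (\<Sum>x\<in>lo. \<bar>w x\<bar> * 2 ^ snd (g x))"
  show thesis
  proof (rule that)
    fix a u :: real assume a: "a \<ge> 1" and u: "u \<in> {1..2}"
    define f where "f x = u ^ snd (g x) * a powi fst (g x)" for x
    have "(\<Sum>x\<in>hi. w x * f x) = (\<Sum>y\<in>Y. \<Sum>x | x \<in> hi \<and> g x = y. w x * f x)"
    proof (rule sum.group [symmetric])
      show "g ` hi \<subseteq> Y"
        using e branch_exp_le by (force simp: hi_def g_def Y_def obstructions_def)
    qed (use fin \<open>finite Y\<close> in auto)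
    also have "\<dots> = 0"
    proof (rule sum.neutral, rule ballI)
      fix y assume y: "y \<in> Y"
      \<comment> \<open>The condition defining \<open>hi\<close> is automatic here, as elements of
        \<open>Y\<close> have exponent at least 2.\<close>
      then have hi_y: "{x. x \<in> hi \<and> g x = y} =
          (SIGMA x:monomials N. {t. t \<in> branch_terms x \<and> branch_exp x t = y})"
        by (auto simp: hi_def g_def Y_def obstructions_def)
      have "(\<Sum>x | x \<in> hi \<and> g x = y. w x) = (\<Sum>x\<in>monomials N. c x * obstruction_coeff (e, y) x)"
        unfolding hi_y obstruction_coeff_def w_def
        by (subst sum.Sigma [symmetric]) (auto simp: finite_monomials sum_distrib_left)
      also have "\<dots> = 0" using zero y by (simp add: Y_def)
      finally have "(\<Sum>x | x \<in> hi \<and> g x = y. w x) = 0" .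
      moreover have "(\<Sum>x | x \<in> hi \<and> g x = y. w x * f x) =
          (\<Sum>x | x \<in> hi \<and> g x = y. w x) * (u ^ snd y * a powi fst y)"
        unfolding sum_distrib_right by (intro sum.cong) (auto simp: f_def)
      ultimately show "(\<Sum>x | x \<in> hi \<and> g x = y. w x * f x) = 0" by simp
    qed
    finally have hi0: "(\<Sum>x\<in>hi. w x * f x) = 0" .
    have "bipoly_eval (bipoly_of (monomials N) c) (a, branch e a u) = (\<Sum>x\<in>?X. w x * f x)"
      using a by (subst bipoly_of_on_branch) (auto simp: finite_monomials w_def f_def g_def split_def)
    also have "?X = hi \<union> lo" by (auto simp: hi_def lo_def)
    also have "(\<Sum>x\<in>hi \<union> lo. w x * f x) = (\<Sum>x\<in>lo. w x * f x)"
    proof -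
      have "hi \<inter> lo = {}" by (auto simp: hi_def lo_def)
      with fin hi0 show ?thesis by (simp add: sum.union_disjoint)
    qed
    also have "\<bar>\<dots>\<bar> \<le> (\<Sum>x\<in>lo. \<bar>w x * f x\<bar>)" by (rule sum_abs)
    also have "\<dots> \<le> (\<Sum>x\<in>lo. \<bar>w x\<bar> * 2 ^ snd (g x) * a)"
    proof (rule sum_mono)
      fix x assume "x \<in> lo"
      then have "a powi fst (g x) \<le> a powi 1" using a
        by (intro power_int_increasing) (auto simp: lo_def)
      moreover have "u ^ snd (g x) \<le> 2 ^ snd (g x)" using u by (intro power_mono) auto
      ultimately have "u ^ snd (g x) * a powi fst (g x) \<le> 2 ^ snd (g x) * a"
        using u a by (intro mult_mono) auto
      then have "\<bar>f x\<bar> \<le> 2 ^ snd (g x) * a" using u a by (simp add: f_def abs_mult)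
      then have "\<bar>w x\<bar> * \<bar>f x\<bar> \<le> \<bar>w x\<bar> * (2 ^ snd (g x) * a)" by (intro mult_left_mono) auto
      then show "\<bar>w x * f x\<bar> \<le> \<bar>w x\<bar> * 2 ^ snd (g x) * a" by (simp add: abs_mult mult.assoc)
    qed
    also have "\<dots> = C * a" by (simp add: C_def sum_distrib_right)
    finally show "\<bar>bipoly_eval (bipoly_of (monomials N) c) (a, branch e a u)\<bar> \<le> C * a" .
  qed
qed

section \<open>Infinite dimension for \<open>d = 1\<close>\<close>

lemma bipoly_of_in_growth_space_1:
  assumes "\<And>y. y \<in> obstructions N \<Longrightarrow> (\<Sum>x\<in>monomials N. c x * obstruction_coeff y x) = 0"
  shows "bipoly_of (monomials N) c \<in> growth_space 1 (S1 \<union> S2)"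
proof -
  let ?p = "bipoly_of (monomials N) c"
  obtain C1 where C1: "\<And>a u. \<lbrakk>a \<ge> 1; u \<in> {1..2}\<rbrakk> \<Longrightarrow> \<bar>bipoly_eval ?p (a, branch 1 a u)\<bar> \<le> C1 * a"
    using bipoly_of_bounded_on_branch[where e = 1, OF assms] by blast
  obtain C2 where C2: "\<And>a u. \<lbrakk>a \<ge> 1; u \<in> {1..2}\<rbrakk> \<Longrightarrow> \<bar>bipoly_eval ?p (a, branch (-1) a u)\<bar> \<le> C2 * a"
    using bipoly_of_bounded_on_branch[where e = "-1", OF assms] by blast
  define C where "C = max C1 C2"
  \<comment> \<open>\<open>q\<close> is \<open>C^2 * x1^2\<close>, of the largest degree allowed for
    \<open>d = 1\<close>.\<close>
  define q where "q = monom (monom (C\<^sup>2) 2) 0"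
  have "total_degree q \<le> 2 * 1"
    unfolding q_def total_degree_le_iff by (auto simp: coeff_monom split: if_splits)
  moreover have "(bipoly_eval ?p s)\<^sup>2 \<le> bipoly_eval q s" if s: "s \<in> S1 \<union> S2" for s
  proof -
    obtain a e u where s: "s = (a, branch e a u)" "e \<in> {1, -1}" "a \<ge> 1" "u \<in> {1..2}"
      using s unfolding S1_Un_S2_eq by auto
    have "C1 * a \<le> C * a" "C2 * a \<le> C * a" using s(3) by (auto simp: C_def)
    with C1[OF s(3,4)] C2[OF s(3,4)] s(2) have "\<bar>bipoly_eval ?p s\<bar> \<le> C * a"
      unfolding s(1) by (auto intro: order.trans)
    then have "\<bar>bipoly_eval ?p s\<bar>\<^sup>2 \<le> (C * a)\<^sup>2" by (rule power_mono) simp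
    then show ?thesis by (simp add: s(1) q_def bipoly_eval_monom power_mult_distrib)
  qed
  ultimately show ?thesis unfolding growth_space_def by blast
qed

text \<open>A finite spanning set involves only a finite set \<open>T\<close> of monomials, but the
  growth space has a nonzero element without any monomial of \<open>T\<close>.\<close>

lemma infinite_dimensional_growth_space_1: "infinite_dimensional (growth_space 1 (S1 \<union> S2))"
  unfolding infinite_dimensional_def
proof
  assume "\<exists>F. finite F \<and> bipoly.span F = growth_space 1 (S1 \<union> S2)"
  then obtain F where F: "finite F" "bipoly.span F = growth_space 1 (S1 \<union> S2)" by blast
  define T where "T = (\<Union>f\<in>F. bipoly_support f)"
  have "finite T" using F(1) finite_bipoly_support by (auto simp: T_def)
  have supp: "coeff (coeff p j) i = 0" if "p \<in> bipoly.span F" "(i, j) \<notin> T" for p i j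
    using that(1)
  proof (induction rule: bipoly.span_induct_alt)
    case (step c f q)
    then have "coeff (coeff f j) i = 0" using that(2) by (auto simp: T_def bipoly_support_def)
    with step show ?case by (simp add: coeff_bipoly_const_mult)
  qed simp
  \<comment> \<open>With this \<open>m\<close> there are \<open>card T + 1\<close> more monomials
    than obstructions, just enough for \<open>card T\<close> further conditions.\<close>
  define m where "m = card T"
  define N where "N = 6 * m"
  \<comment> \<open>Forcing the coefficients on \<open>T\<close> to vanish as well leaves no room for a nonzero element of the span.\<close>
  define B where "B = obstructions N <+> T"
  define M where "M b x = (case b of Inl y \<Rightarrow> obstruction_coeff y x | Inr t \<Rightarrow> if x = t then 1 else 0)"
    for b x
  have "finite B" using \<open>finite T\<close> by (simp add: B_def finite_obstructions)
  moreover have "card B < card (monomials N)"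
    using card_obstructions[of m] card_monomials[of m] \<open>finite T\<close>
    by (simp add: B_def card_Plus finite_obstructions N_def flip: m_def)
  ultimately obtain c where nz: "\<exists>x\<in>monomials N. c x \<noteq> 0"
    and c: "\<And>b. b \<in> B \<Longrightarrow> (\<Sum>x\<in>monomials N. c x * M b x) = 0"
    using exists_nontrivial_solution[of B "monomials N" M] finite_monomials by blast
  have "(\<Sum>x\<in>monomials N. c x * obstruction_coeff y x) = 0" if "y \<in> obstructions N" for y
    using c[of "Inl y"] InlI[OF that, of T] by (simp add: B_def M_def)
  then have span: "bipoly_of (monomials N) c \<in> bipoly.span F"
    unfolding F(2) by (rule bipoly_of_in_growth_space_1)
  have "c (i, j) = 0" if E: "(i, j) \<in> monomials N" for i j
  proof (cases "(i, j) \<in> T")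
    case True
    then have "(\<Sum>x\<in>monomials N. c x * (if x = (i, j) then 1 else 0)) = 0"
      using c[of "Inr (i, j)"] InrI[OF True, of "obstructions N"] by (simp add: B_def M_def)
    moreover have "(\<Sum>x\<in>monomials N. c x * (if x = (i, j) then 1 else 0)) = c (i, j)"
      using E by (simp add: if_distrib finite_monomials cong: if_cong)
    ultimately show ?thesis by simp
  next
    case False
    from supp[OF span this] E show ?thesis by (simp add: coeff_bipoly_of finite_monomials)
  qed
  with nz show False by auto
qed

theorem theorem3p1:
  shows "growth_space 0 (S1 \<union> S2) = range bipoly_const \<and>
    bipoly.subspace (growth_space 1 (S1 \<union> S2)) \<and>
    infinite_dimensional (growth_space 1 (S1 \<union> S2))"
  using growth_space_0_subset bipoly_const_in_growth_space subspace_growth_space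
    infinite_dimensional_growth_space_1 by blast

end
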